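(* $\operatorname{Av}(2143,4312)=\mathcal{E}\cup\mathcal{F}$, where $\mathcal{E}$ and $\mathcal{F}$ are the following monotone grid classes (cells written as (column, row), all unlisted cells empty): $\mathcal{E}$: 4 columns, 6 rows; increasing cells $(1,1),(1,4),(2,2),(2,5),(3,3),(4,6)$; decreasing cells $(3,2),(4,1)$. $\mathcal{F}$: 6 columns, 4 rows; increasing cells $(1,1),(2,3),(3,4),(4,2),(5,3),(6,4)$; decreasing cells $(5,2),(6,1)$.
   Context: Pattern containment: $\pi$ contains $\sigma$ if some subsequence of $\pi$ is order-isomorphic to $\sigma$; $\operatorname{Av}(B)$ is the set of permutations containing no element of $B$. Monotone grid class: columns numbered $1,\dots,k$ left to right, rows $1,\dots,l$ bottom to top; a permutation $\pi$ of length $n$ belongs to the class if there are $0=c_0\le\dots\le c_k=n$ and $0=r_0\le\dots\le r_l=n$ such that for each cell $(i,j)$ the points $(p,\pi(p))$ with $c_{i-1}<p\le c_i$, $r_{j-1}<\pi(p)\le r_j$ form an increasing (resp. decreasing) sequence, possibly empty, if the cell is increasing (resp. decreasing), and there are no such points if the cell is empty. *)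

theory Defs
  imports "HOL-Library.Sublist" "HOL-Combinatorics.Multiset_Permutations"
begin

text \<open>Permutations of length \<open>n\<close> are in one-line notation: \<open>\<pi>(p)\<close> is the list entry \<open>\<pi> ! (p - 1)\<close>.\<close>

definition perms :: "nat list set" where
  "perms = (\<Union>n. permutations_of_set {1..n})"

definition order_isomorphic :: "nat list \<Rightarrow> nat list \<Rightarrow> bool" where
  "order_isomorphic xs ys \<longleftrightarrow> length xs = length ys \<and>
     (\<forall>i < length xs. \<forall>j < length xs. xs ! i < xs ! j \<longleftrightarrow> ys ! i < ys ! j)"

definition contains_pattern :: "nat list \<Rightarrow> nat list \<Rightarrow> bool" where
  "contains_pattern \<pi> \<sigma> \<longleftrightarrow> (\<exists>\<tau>. subseq \<tau> \<pi> \<and> order_isomorphic \<tau> \<sigma>)"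

definition Av :: "nat list set \<Rightarrow> nat list set" where
  "Av B = {\<pi> \<in> perms. \<forall>\<sigma> \<in> B. \<not> contains_pattern \<pi> \<sigma>}"

datatype cell = Empty | Increasing | Decreasing

definition points :: "nat list \<Rightarrow> (nat \<times> nat) set" where
  "points \<pi> = {(p, \<pi> ! (p - 1)) | p. 1 \<le> p \<and> p \<le> length \<pi>}"

fun conforms :: "cell \<Rightarrow> (nat \<times> nat) set \<Rightarrow> bool" where
  "conforms Empty S \<longleftrightarrow> S = {}"
| "conforms Increasing S \<longleftrightarrow> (\<forall>(p, v) \<in> S. \<forall>(q, w) \<in> S. p < q \<longrightarrow> v < w)"
| "conforms Decreasing S \<longleftrightarrow> (\<forall>(p, v) \<in> S. \<forall>(q, w) \<in> S. p < q \<longrightarrow> v > w)"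

text \<open>A gridding matrix \<open>M\<close> takes the column number first (from the left), then the row number
  (from the bottom), both starting at 1.\<close>

definition grid_class :: "nat \<Rightarrow> nat \<Rightarrow> (nat \<Rightarrow> nat \<Rightarrow> cell) \<Rightarrow> nat list set" where
  "grid_class k l M = {\<pi> \<in> perms. \<exists>c r :: nat \<Rightarrow> nat.
     c 0 = 0 \<and> c k = length \<pi> \<and> mono_on {0..k} c \<and>
     r 0 = 0 \<and> r l = length \<pi> \<and> mono_on {0..l} r \<and>
     (\<forall>i \<in> {1..k}. \<forall>j \<in> {1..l}.
        conforms (M i j) (points \<pi> \<inter> ({c (i - 1)<..c i} \<times> {r (j - 1)<..r j})))}"

definition cells :: "(nat \<times> nat) set \<Rightarrow> (nat \<times> nat) set \<Rightarrow> nat \<Rightarrow> nat \<Rightarrow> cell" where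
  "cells I D i j =
     (if (i, j) \<in> I then Increasing else if (i, j) \<in> D then Decreasing else Empty)"

definition class_E :: "nat list set" where
  "class_E = grid_class 4 6
     (cells {(1,1), (1,4), (2,2), (2,5), (3,3), (4,6)} {(3,2), (4,1)})"

definition class_F :: "nat list set" where
  "class_F = grid_class 6 4
     (cells {(1,1), (2,3), (3,4), (4,2), (5,3), (6,4)} {(5,2), (6,1)})"

end

theory Submission
  imports Defs
begin

text \<open>The reverse-complement-inverse \<open>(x, y) \<mapsto> (-y, -x)\<close> fixes both patterns and exchanges the two
  grid classes, so only \<open>class_E\<close> is treated by hand.

  For a permutation that avoids both patterns and is not increasing, let \<open>w\<close> be the leftmost and
  \<open>v\<close> the highest point that has a point to its upper left. Then some \<open>t\<close> lies to the upper left of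
  both, the points left of \<open>w\<close> are increasing, and so are the points above \<open>v\<close>. As \<open>2143\<close> is
  avoided, either no point left of \<open>w\<close> has its value between those of \<open>w\<close> and \<open>v\<close>, or, symmetrically,
  no point above \<open>v\<close> has its position between those of \<open>w\<close> and \<open>v\<close>. In the first case \<open>4312\<close>
  forbids \<open>312\<close> at height at most \<open>v\<close>. Let \<open>n\<close> be the lowest end of a \<open>213\<close> there and \<open>p\<close> the point
  just below it: the points up to \<open>p\<close> are unimodal with peak \<open>p\<close>, while those from \<open>n\<close> up to \<open>v\<close> are
  increasing, since all of them extend one descent starting at \<open>p\<close>.\<close>

lemma finite_max:
  fixes f :: "'a \<Rightarrow> 'b::linorder"
  assumes "finite A" "A \<noteq> {}"
  shows "\<exists>x\<in>A. \<forall>y\<in>A. f y \<le> f x"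
proof -
  have "Max (f ` A) \<in> f ` A" using assms by simp
  then obtain x where "x \<in> A" "Max (f ` A) = f x" by blast
  then show ?thesis using assms by (metis Max_ge finite_imageI image_eqI)
qed

lemma finite_min:
  fixes f :: "'a \<Rightarrow> 'b::linorder"
  assumes "finite A" "A \<noteq> {}"
  shows "\<exists>x\<in>A. \<forall>y\<in>A. f x \<le> f y"
proof -
  have "Min (f ` A) \<in> f ` A" using assms by simp
  then obtain x where "x \<in> A" "Min (f ` A) = f x" by blast
  then show ?thesis using assms by (metis Min_le finite_imageI image_eqI)
qed

section \<open>Griddings of planar point sets\<close>

text \<open>The grid lines are encoded by the column \<open>C\<close> and the row \<open>R\<close> of each point.\<close>

definition gridded ::
  "'a set \<Rightarrow> ('a \<Rightarrow> int) \<Rightarrow> ('a \<Rightarrow> int) \<Rightarrow> nat \<Rightarrow> nat \<Rightarrow> (nat \<Rightarrow> nat \<Rightarrow> cell) \<Rightarrow> bool" where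
  "gridded S pos val k l M \<longleftrightarrow> (\<exists>C R. \<forall>x\<in>S. C x \<in> {1..k} \<and> R x \<in> {1..l} \<and> M (C x) (R x) \<noteq> Empty \<and>
     (\<forall>y\<in>S. (pos x < pos y \<longrightarrow> C x \<le> C y) \<and> (val x < val y \<longrightarrow> R x \<le> R y) \<and>
        (pos x < pos y \<longrightarrow> C x = C y \<longrightarrow> R x = R y \<longrightarrow>
          (M (C x) (R x) = Increasing \<longrightarrow> val x < val y) \<and>
          (M (C x) (R x) = Decreasing \<longrightarrow> val y < val x))))"

text \<open>The two excluded shapes are 2143 and 4312, with \<open>a\<close>, \<open>b\<close>,
  \<open>c\<close>, \<open>d\<close> in order of position. Coordinates are integers so that the
  reflection can negate them.\<close>

definition avoids :: "'a set \<Rightarrow> ('a \<Rightarrow> int) \<Rightarrow> ('a \<Rightarrow> int) \<Rightarrow> bool" where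
  "avoids S pos val \<longleftrightarrow> (\<forall>a\<in>S. \<forall>b\<in>S. \<forall>c\<in>S. \<forall>d\<in>S. pos a < pos b \<longrightarrow> pos b < pos c \<longrightarrow> pos c < pos d \<longrightarrow>
     \<not> (val b < val a \<and> val a < val d \<and> val d < val c) \<and>
     \<not> (val c < val d \<and> val d < val b \<and> val b < val a))"

abbreviation matrix_E :: "nat \<Rightarrow> nat \<Rightarrow> cell" where
  "matrix_E \<equiv> cells {(1,1), (1,4), (2,2), (2,5), (3,3), (4,6)} {(3,2), (4,1)}"

abbreviation matrix_F :: "nat \<Rightarrow> nat \<Rightarrow> cell" where
  "matrix_F \<equiv> cells {(1,1), (2,3), (3,4), (4,2), (5,3), (6,4)} {(5,2), (6,1)}"

text \<open>The map (x, y) to (-y, -x) exchanges columns and rows, reverses their order, and keeps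
  increasing sequences increasing and decreasing ones decreasing. Injectivity of \<open>val\<close>
  makes any two distinct points comparable in the reflected gridding.\<close>

lemma gridded_reflect:
  assumes "gridded S (\<lambda>x. - val x) (\<lambda>x. - pos x) k l M"
    and "inj_on val S"
    and M': "\<And>i j. i \<in> {1..l} \<Longrightarrow> j \<in> {1..k} \<Longrightarrow> M' i j = M (k + 1 - j) (l + 1 - i)"
  shows "gridded S pos val l k M'"
proof -
  obtain C R where CR: "\<And>x. x \<in> S \<Longrightarrow> C x \<in> {1..k}" "\<And>x. x \<in> S \<Longrightarrow> R x \<in> {1..l}"
      "\<And>x. x \<in> S \<Longrightarrow> M (C x) (R x) \<noteq> Empty"
    and mono: "\<And>x y. x \<in> S \<Longrightarrow> y \<in> S \<Longrightarrow> val y < val x \<Longrightarrow> C x \<le> C y"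
      "\<And>x y. x \<in> S \<Longrightarrow> y \<in> S \<Longrightarrow> pos y < pos x \<Longrightarrow> R x \<le> R y"
    and cell: "\<And>x y. x \<in> S \<Longrightarrow> y \<in> S \<Longrightarrow> val y < val x \<Longrightarrow> C x = C y \<Longrightarrow> R x = R y \<Longrightarrow>
       (M (C x) (R x) = Increasing \<longrightarrow> pos y < pos x) \<and> (M (C x) (R x) = Decreasing \<longrightarrow> pos x < pos y)"
    using assms(1) unfolding gridded_def by (auto simp del: atLeastAtMost_iff)
  define C' where "C' x = l + 1 - R x" for x
  define R' where "R' x = k + 1 - C x" for x
  have range: "C' x \<in> {1..l}" "R' x \<in> {1..k}" if "x \<in> S" for x
    using CR(1,2)[OF that] by (auto simp: C'_def R'_def)
  have entry: "M' (C' x) (R' x) = M (C x) (R x)" if "x \<in> S" for x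
    using CR(1,2)[OF that] M'[OF range[OF that]] by (simp add: C'_def R'_def)
  have eq: "C x = C y" "R x = R y" if "C' x = C' y" "R' x = R' y" "x \<in> S" "y \<in> S" for x y
    using that CR(1,2)[of x] CR(1,2)[of y] by (auto simp: C'_def R'_def)
  have cell': "(M (C x) (R x) = Increasing \<longrightarrow> val x < val y) \<and> (M (C x) (R x) = Decreasing \<longrightarrow> val y < val x)"
    if "x \<in> S" "y \<in> S" "pos x < pos y" "C' x = C' y" "R' x = R' y" for x y
  proof -
    have "val x \<noteq> val y" using that inj_onD[OF assms(2)] by auto
    then consider "val x < val y" | "val y < val x" by linarith
    then show ?thesis
      using cell[of x y] cell[of y x] eq[of x y] that by cases auto
  qed
  show ?thesis
    unfolding gridded_def
  proof (rule exI[of _ C'], rule exI[of _ R'], intro ballI conjI impI)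
    fix x assume x: "x \<in> S"
    show "C' x \<in> {1..l}" "R' x \<in> {1..k}" "M' (C' x) (R' x) \<noteq> Empty"
      using range entry CR(3) x by auto
    fix y assume y: "y \<in> S"
    show "C' x \<le> C' y" if "pos x < pos y"
      using mono(2)[OF y x that] by (simp add: C'_def)
    show "R' x \<le> R' y" if "val x < val y"
      using mono(1)[OF y x that] by (simp add: R'_def)
    assume "pos x < pos y" "C' x = C' y" "R' x = R' y"
    note cell'[OF x y this]
    then show "M' (C' x) (R' x) = Increasing \<Longrightarrow> val x < val y"
      "M' (C' x) (R' x) = Decreasing \<Longrightarrow> val y < val x"
      using entry[OF x] by auto
  qed
qed

lemma matrix_reflect:
  assumes "i \<in> {1..6}" "j \<in> {1..4}"
  shows "matrix_F i j = matrix_E (4 + 1 - j) (6 + 1 - i)" "matrix_E j i = matrix_F (6 + 1 - i) (4 + 1 - j)"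
proof -
  have "i \<in> {1, 2, 3, 4, 5, 6}" "j \<in> {1, 2, 3, 4}" using assms by auto
  then show "matrix_F i j = matrix_E (4 + 1 - j) (6 + 1 - i)" "matrix_E j i = matrix_F (6 + 1 - i) (4 + 1 - j)"
    by (elim insertE emptyE; simp add: cells_def)+
qed

lemma gridded_F_iff_gridded_E:
  assumes "inj_on pos S" "inj_on val S"
  shows "gridded S pos val 6 4 matrix_F \<longleftrightarrow> gridded S (\<lambda>x. - val x) (\<lambda>x. - pos x) 4 6 matrix_E"
proof
  assume "gridded S (\<lambda>x. - val x) (\<lambda>x. - pos x) 4 6 matrix_E"
  then show "gridded S pos val 6 4 matrix_F"
    using assms(2) matrix_reflect(1) by (rule gridded_reflect)
next
  assume F: "gridded S pos val 6 4 matrix_F"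
  have inj: "inj_on (\<lambda>x. - pos x) S" using assms(1) by (simp add: inj_on_def)
  show "gridded S (\<lambda>x. - val x) (\<lambda>x. - pos x) 4 6 matrix_E"
    \<comment> \<open>Reflecting twice restores the coordinates, so the same lemma gives the
      converse.\<close>
    by (rule gridded_reflect[where pos = "\<lambda>x. - val x" and val = "\<lambda>x. - pos x" and M = matrix_F, OF _ inj matrix_reflect(2)]) (use F in simp_all)
qed

text \<open>Both patterns are fixed by the reflection: a reflected copy \<open>a b c d\<close> reads
  in the original coordinates as \<open>c d a b\<close> for 2143 and as \<open>a b d c\<close> for
  4312.\<close>

lemma avoids_reflect:
  assumes "avoids S pos val"
  shows "avoids S (\<lambda>x. - val x) (\<lambda>x. - pos x)"
  unfolding avoids_def
proof (intro ballI impI conjI notI; elim conjE)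
  fix a b c d assume "a \<in> S" "b \<in> S" "c \<in> S" "d \<in> S"
    and "- val a < - val b" "- val b < - val c" "- val c < - val d"
    and "- pos b < - pos a" "- pos a < - pos d" "- pos d < - pos c"
  then show False
    using assms[unfolded avoids_def, rule_format, of c d a b] by simp
next
  fix a b c d assume "a \<in> S" "b \<in> S" "c \<in> S" "d \<in> S"
    and "- val a < - val b" "- val b < - val c" "- val c < - val d"
    and "- pos c < - pos d" "- pos d < - pos b" "- pos b < - pos a"
  then show False
    using assms[unfolded avoids_def, rule_format, of a b d c] by simp
qed

section \<open>The grid classes avoid both patterns\<close>

lemma matrix_E_nonempty:
  assumes "matrix_E i j \<noteq> Empty"
  shows "(i, j) \<in> {(1,1), (1,4), (2,2), (2,5), (3,3), (4,6), (3,2), (4,1)}"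
  using assms by (auto simp: cells_def split: if_splits)

text \<open>Rows 4 to 6 together are increasing, and so are columns 1 and 2 below row 4; columns 3
  and 4 below row 3 are decreasing. These facts (\<open>high\<close>, \<open>left\<close>,
  \<open>mid\<close>) push two points of either pattern, \<open>c d\<close> of 2143 and
  \<open>b d\<close> of 4312, into the increasing cell (3,3), where they would form a
  descent.\<close>

lemma gridded_E_avoids:
  assumes "gridded S pos val 4 6 matrix_E"
  shows "avoids S pos val"
proof -
  obtain C R where ne: "\<And>x. x \<in> S \<Longrightarrow> matrix_E (C x) (R x) \<noteq> Empty"
    and C: "\<And>x y. x \<in> S \<Longrightarrow> y \<in> S \<Longrightarrow> pos x < pos y \<Longrightarrow> C x \<le> C y"
    and R: "\<And>x y. x \<in> S \<Longrightarrow> y \<in> S \<Longrightarrow> val x < val y \<Longrightarrow> R x \<le> R y"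
    and cell: "\<And>x y. x \<in> S \<Longrightarrow> y \<in> S \<Longrightarrow> pos x < pos y \<Longrightarrow> C x = C y \<Longrightarrow> R x = R y \<Longrightarrow>
       (matrix_E (C x) (R x) = Increasing \<longrightarrow> val x < val y) \<and>
       (matrix_E (C x) (R x) = Decreasing \<longrightarrow> val y < val x)"
    using assms unfolding gridded_def by blast
  note cases = matrix_E_nonempty[OF ne]
  have high: "R y \<le> 3" if "x \<in> S" "y \<in> S" "pos x < pos y" "val y < val x" for x y
    using that cases[of x] cases[of y] C[of x y] R[of y x] cell[of x y]
    by (auto simp: cells_def)
  have left: "C y \<ge> 3" if "x \<in> S" "y \<in> S" "pos x < pos y" "val y < val x" "R x \<le> 3" for x y
    using that cases[of x] cases[of y] C[of x y] R[of y x] cell[of x y]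
    by (auto simp: cells_def)
  have mid: "R y \<ge> 3" if "x \<in> S" "y \<in> S" "pos x < pos y" "val x < val y" "C x \<ge> 3" for x y
    using that cases[of x] cases[of y] C[of x y] R[of x y] cell[of x y]
    by (auto simp: cells_def)
  have inc: "val x < val y" if "x \<in> S" "y \<in> S" "pos x < pos y" "C x = 3" "R x = 3" "C y = 3" "R y = 3" for x y
    using that cell[of x y] by (auto simp: cells_def)
  have row3: "C x = 3" if "x \<in> S" "R x = 3" for x
    using that cases[of x] by auto
  have col3: "R x \<le> 3" if "x \<in> S" "C x = 3" for x
    using that cases[of x] by auto
  show ?thesis
    unfolding avoids_def
  proof (intro ballI impI conjI notI; elim conjE)
    fix a b c d assume S: "a \<in> S" "b \<in> S" "c \<in> S" "d \<in> S"
      and p: "pos a < pos b" "pos b < pos c" "pos c < pos d"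
      and v: "val b < val a" "val a < val d" "val d < val c"
    have "R d \<le> 3" using high[of c d] S p v by simp
    then have "R a \<le> 3" using R[of a d] S v by simp
    then have "C b \<ge> 3" using left[of a b] S p v by simp
    then have "R d \<ge> 3" using mid[of b d] S p v by simp
    with \<open>R d \<le> 3\<close> have d: "R d = 3" "C d = 3" using row3[of d] S by auto
    have "C c = 3" using C[of b c] C[of c d] \<open>C b \<ge> 3\<close> d S p by simp
    moreover have "R c = 3" using col3[of c] \<open>C c = 3\<close> R[of d c] d S v by simp
    ultimately show False using inc[of c d] d S p v by simp
  next
    fix a b c d assume S: "a \<in> S" "b \<in> S" "c \<in> S" "d \<in> S"
      and p: "pos a < pos b" "pos b < pos c" "pos c < pos d"
      and v: "val c < val d" "val d < val b" "val b < val a"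
    have "R b \<le> 3" using high[of a b] S p v by simp
    then have "C c \<ge> 3" using left[of b c] S p v by simp
    then have "R d \<ge> 3" using mid[of c d] S p v by simp
    moreover have "R d \<le> R b" using R[of d b] S v by simp
    ultimately have "R d = 3" "R b = 3" using \<open>R b \<le> 3\<close> by auto
    then show False using inc[of b d] row3[of b] row3[of d] S p v by simp
  qed
qed

section \<open>Avoiders are gridded\<close>

text \<open>The class \<open>class_E\<close> in terms of only two vertical and two horizontal lines.\<close>

lemma gridded_EI:
  fixes \<alpha> \<beta> \<rho> \<sigma> :: int
  assumes inj: "inj_on pos S" "inj_on val S" and le: "\<alpha> \<le> \<beta>" "\<rho> \<le> \<sigma>"
    and low_left: "\<And>x y. x \<in> S \<Longrightarrow> y \<in> S \<Longrightarrow> val x \<le> \<rho> \<Longrightarrow> val y \<le> \<rho> \<Longrightarrow> pos x < pos y \<Longrightarrow> pos y \<le> \<alpha> \<Longrightarrow> val x < val y"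
    and low_right: "\<And>x y. x \<in> S \<Longrightarrow> y \<in> S \<Longrightarrow> val x \<le> \<rho> \<Longrightarrow> val y \<le> \<rho> \<Longrightarrow> \<alpha> < pos x \<Longrightarrow> pos x < pos y \<Longrightarrow> val y < val x"
    and mid: "\<And>x. x \<in> S \<Longrightarrow> \<rho> < val x \<Longrightarrow> val x \<le> \<sigma> \<Longrightarrow> \<alpha> < pos x \<and> pos x \<le> \<beta>"
      "\<And>x y. x \<in> S \<Longrightarrow> y \<in> S \<Longrightarrow> \<rho> < val x \<Longrightarrow> val x \<le> \<sigma> \<Longrightarrow> \<rho> < val y \<Longrightarrow> val y \<le> \<sigma> \<Longrightarrow> pos x < pos y \<Longrightarrow> val x < val y"
    and high: "\<And>x. x \<in> S \<Longrightarrow> \<sigma> < val x \<Longrightarrow> pos x \<le> \<alpha> \<or> \<beta> < pos x"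
      "\<And>x y. x \<in> S \<Longrightarrow> y \<in> S \<Longrightarrow> \<sigma> < val x \<Longrightarrow> \<sigma> < val y \<Longrightarrow> pos x < pos y \<Longrightarrow> val x < val y"
  shows "gridded S pos val 4 6 matrix_E"
proof -
  \<comment> \<open>\<open>bottom\<close> cuts rows 1 and 2 just above the highest low point beyond
    \<beta>, so that column 4 has low points in row 1 only. \<open>first\<close> cuts columns 1 and
    2 just after the last bottom point up to \<alpha>.\<close>
  define bottom where "bottom x \<longleftrightarrow> (\<exists>z\<in>S. \<beta> < pos z \<and> val z \<le> \<rho> \<and> val x \<le> val z)" for x
  define first where "first x \<longleftrightarrow> (\<exists>y\<in>S. bottom y \<and> pos y \<le> \<alpha> \<and> pos x \<le> pos y)" for x
  define C :: "'a \<Rightarrow> nat" where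
    "C x = (if pos x \<le> \<alpha> then if first x then 1 else 2 else if pos x \<le> \<beta> then 3 else 4)" for x
  define R :: "'a \<Rightarrow> nat" where
    "R x = (if val x \<le> \<rho> then if bottom x then 1 else 2 else if val x \<le> \<sigma> then 3
            else if pos x \<le> \<alpha> then if first x then 4 else 5 else 6)" for x
  have bottom_le: "bottom x" if "bottom y" "val x \<le> val y" for x y
    using that order_trans unfolding bottom_def by blast
  have bottom_low: "val x \<le> \<rho>" if "bottom x" for x
    using that unfolding bottom_def by auto
  have first_le: "first x" if "first y" "pos x \<le> pos y" for x y
    using that order_trans unfolding first_def by blast
  \<comment> \<open>The low points up to \<alpha> are increasing, so cutting them by position or by
    value is the same, and only the cells (1,1) and (2,2) are occupied.\<close>
  have first_iff: "first x \<longleftrightarrow> bottom x" if "x \<in> S" "val x \<le> \<rho>" "pos x \<le> \<alpha>" for x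
  proof
    assume "first x"
    then obtain y where y: "y \<in> S" "bottom y" "pos y \<le> \<alpha>" "pos x \<le> pos y"
      unfolding first_def by blast
    then have "val x \<le> val y"
      using low_left[of x y] that bottom_low[of y] inj_onD[OF inj(1), of x y] by force
    then show "bottom x" using y bottom_le by blast
  qed (use that first_def in auto)
  \<comment> \<open>The low points after \<alpha> are decreasing, so those up to \<beta> lie above
    those beyond it.\<close>
  have not_bottom: "\<not> bottom x" if "x \<in> S" "val x \<le> \<rho>" "\<alpha> < pos x" "pos x \<le> \<beta>" for x
    using low_right[OF that(1) _ that(2)] that unfolding bottom_def by force
  have bottom: "bottom x" if "x \<in> S" "val x \<le> \<rho>" "\<beta> < pos x" for x
    using that unfolding bottom_def by blast
  have range: "C x \<in> {1..4}" "R x \<in> {1..6}" for x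
    by (auto simp: C_def R_def)
  have cells: "(C x, R x) \<in> (if val x \<le> \<rho> then if pos x \<le> \<alpha> then {(1,1), (2,2)} else if pos x \<le> \<beta> then {(3,2)} else {(4,1)}
      else if val x \<le> \<sigma> then {(3,3)} else if pos x \<le> \<alpha> then {(1,4), (2,5)} else {(4,6)})"
    if "x \<in> S" for x
    using le first_iff[OF that] not_bottom[OF that] bottom[OF that] mid(1)[OF that] high(1)[OF that]
    by (cases "val x \<le> \<rho>"; cases "val x \<le> \<sigma>"; cases "pos x \<le> \<alpha>"; cases "pos x \<le> \<beta>")
      (simp_all add: C_def R_def)
  have C_mono: "C x \<le> C y" if "pos x < pos y" for x y
    using that le first_le[of y x] by (auto simp: C_def)
  \<comment> \<open>Rows 4 to 6 are assigned by position; this respects values because the points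
    above \<sigma> are increasing.\<close>
  have R_mono: "R x \<le> R y" if "x \<in> S" "y \<in> S" "val x < val y" for x y
  proof (cases "\<sigma> < val x")
    case True
    then have "pos x < pos y"
      using that high(2)[of y x] inj_onD[OF inj(1), of x y] by (metis less_irrefl less_trans not_less_iff_gr_or_eq)
    then show ?thesis
      using that True le first_le[of y x] by (auto simp: R_def)
  next
    case False
    then show ?thesis using that le bottom_le[of y x] by (auto simp: R_def)
  qed
  show ?thesis
    unfolding gridded_def
  proof (rule exI[of _ C], rule exI[of _ R], intro ballI conjI impI)
    fix x assume x: "x \<in> S"
    show "C x \<in> {1..4}" "R x \<in> {1..6}" using range .
    show "matrix_E (C x) (R x) \<noteq> Empty"
      using cells[OF x] by (auto simp: cells_def split: if_splits)
    fix y assume y: "y \<in> S"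
    show "C x \<le> C y" if "pos x < pos y" using C_mono that .
    show "R x \<le> R y" if "val x < val y" using R_mono[OF x y that] .
    assume "pos x < pos y" "C x = C y" "R x = R y"
    then show "val x < val y" if "matrix_E (C x) (R x) = Increasing"
      using that cells[OF x] cells[OF y] low_left[OF x y] mid(2)[OF x y] high(2)[OF x y]
      by (auto simp: cells_def split: if_splits)
    show "val y < val x" if "matrix_E (C x) (R x) = Decreasing"
      using that \<open>pos x < pos y\<close> \<open>C x = C y\<close> \<open>R x = R y\<close> cells[OF x] cells[OF y] low_right[OF x y]
      by (auto simp: cells_def split: if_splits)
  qed
qed

text \<open>The hypotheses on \<open>t\<close>, \<open>v\<close> and \<open>w\<close>, except \<open>sep\<close>, are invariant under the reflection
  that exchanges \<open>v\<close> and \<open>w\<close>.\<close>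

lemma avoids_gridded_E:
  assumes fin: "finite S" and inj: "inj_on pos S" "inj_on val S" and av: "avoids S pos val"
    and S: "t \<in> S" "v \<in> S" "w \<in> S"
    and tvw: "pos t < pos w" "pos w \<le> pos v" "val w \<le> val v" "val v < val t"
    and left: "\<And>x y. x \<in> S \<Longrightarrow> y \<in> S \<Longrightarrow> pos x < pos y \<Longrightarrow> pos y < pos w \<Longrightarrow> val x < val y"
    and high: "\<And>x y. x \<in> S \<Longrightarrow> y \<in> S \<Longrightarrow> val v < val x \<Longrightarrow> val x < val y \<Longrightarrow> pos x < pos y"
    and sep: "\<And>x. x \<in> S \<Longrightarrow> pos x < pos w \<Longrightarrow> val x \<le> val v \<Longrightarrow> val x < val w"
  shows "gridded S pos val 4 6 matrix_E"
proof -
  have no2143: False if "a \<in> S" "b \<in> S" "c \<in> S" "d \<in> S" "pos a < pos b" "pos b < pos c" "pos c < pos d"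
      "val b < val a" "val a < val d" "val d < val c" for a b c d
    using av that unfolding avoids_def by blast
  have no4312: False if "a \<in> S" "b \<in> S" "c \<in> S" "d \<in> S" "pos a < pos b" "pos b < pos c" "pos c < pos d"
      "val c < val d" "val d < val b" "val b < val a" for a b c d
    using av that unfolding avoids_def by blast
  have pos_neq: "pos x < pos y \<or> pos y < pos x" if "x \<in> S" "y \<in> S" "x \<noteq> y" for x y
    using inj_onD[OF inj(1), of x y] that by linarith
  have val_neq: "val x < val y \<or> val y < val x" if "x \<in> S" "y \<in> S" "x \<noteq> y" for x y
    using inj_onD[OF inj(2), of x y] that by linarith
  \<comment> \<open>A 312 starting at or after \<open>w\<close> extends to the 4312
    \<open>t a b c\<close>. If it starts before \<open>w\<close>, then \<open>a\<close> lies below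
    \<open>w\<close> by \<open>sep\<close>, the descent to \<open>b\<close> must end after
    \<open>w\<close>, and \<open>t w b c\<close> is a 4312.\<close>
  have no312: False if "a \<in> S" "b \<in> S" "c \<in> S" "pos a < pos b" "pos b < pos c"
      "val b < val c" "val c < val a" "val a \<le> val v" for a b c
  proof (cases "pos w \<le> pos a")
    case True
    then show False using no4312[of t a b c] that S tvw by linarith
  next
    case False
    then have "val a < val w" using sep that by simp
    moreover have "pos w < pos b"
      using left[of a b] that False pos_neq[of b w] S \<open>val a < val w\<close> by fastforce
    ultimately show False using no4312[of t w b c] that S tvw by linarith
  qed
  \<comment> \<open>The points that play the 3 in a 213 at height at most
    \<open>val v\<close>.\<close>
  define N where "N = {z \<in> S. val z \<le> val v \<and>
    (\<exists>x\<in>S. \<exists>y\<in>S. pos x < pos y \<and> pos y < pos z \<and> val y < val x \<and> val x < val z)}"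
  have high': "val x < val y" if "x \<in> S" "y \<in> S" "val v < val x" "val v < val y" "pos x < pos y" for x y
    using high[of y x] that val_neq[of x y] by force
  \<comment> \<open>A descent before and below \<open>p\<close> would put \<open>p\<close> into
    \<open>N\<close>. In \<open>peak_right\<close>, an ascent after and below \<open>p\<close> would
    complete a 312.\<close>
  have peak_left: "val x < val y"
    if "p \<in> S" "p \<notin> N" "val p \<le> val v" "x \<in> S" "y \<in> S" "val x \<le> val p" "val y \<le> val p" "pos x < pos y" "pos y \<le> pos p"
    for p x y
  proof (rule ccontr)
    assume "\<not> val x < val y"
    then have "val y < val x" using val_neq[of x y] that by auto
    moreover from this have "y \<noteq> p" using that by auto
    then have "pos y < pos p" using pos_neq[of y p] that by auto
    moreover from this have "val x < val p" using val_neq[of x p] that by (cases "x = p") auto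
    ultimately show False using that unfolding N_def by blast
  qed
  have peak_right: "val y < val x"
    if "p \<in> S" "val p \<le> val v" "x \<in> S" "y \<in> S" "val x \<le> val p" "val y \<le> val p" "pos p \<le> pos x" "pos x < pos y"
    for p x y
  proof (rule ccontr)
    assume "\<not> val y < val x"
    then have "val x < val y" using val_neq[of x y] that by auto
    moreover from this have "x \<noteq> p" using that by auto
    then have "pos p < pos x" using pos_neq[of x p] that by auto
    moreover from this have "val y < val p" using val_neq[of y p] that by (cases "y = p") auto
    ultimately show False using no312[of p x y] that by auto
  qed
  show ?thesis
  proof (cases "N = {}")
    case True
    then have "v \<notin> N" by simp
    show ?thesis
      \<comment> \<open>Here \<open>v\<close> is itself the peak of a unimodal set; coinciding lines
        leave column 3 and row 3 empty.\<close>
      by (rule gridded_EI[OF inj, of "pos v" "pos v" "val v" "val v"])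
        (use peak_left[OF S(2) \<open>v \<notin> N\<close>] peak_right[OF S(2)] high' in auto)
  next
    case False
    have "finite N" using fin unfolding N_def by simp
    then obtain n where n: "n \<in> N" and n_min: "\<And>z. z \<in> N \<Longrightarrow> val n \<le> val z"
      using False finite_min[of N val] by blast
    then obtain x y where nS: "n \<in> S" "val n \<le> val v"
      and xy: "x \<in> S" "y \<in> S" "pos x < pos y" "pos y < pos n" "val y < val x" "val x < val n"
      unfolding N_def by blast
    define L where "L = {z \<in> S. val z < val n}"
    have "finite L" "x \<in> L" using fin xy unfolding L_def by auto
    then obtain p where p: "p \<in> L" and p_max: "\<And>z. z \<in> L \<Longrightarrow> val z \<le> val p"
      using finite_max[of L val] by blast
    have pS: "p \<in> S" "val p < val n" using p unfolding L_def by auto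
    have low: "val z \<le> val p" if "z \<in> S" "val z < val n" for z
      using p_max that unfolding L_def by blast
    have "p \<notin> N" using n_min[of p] pS by auto
    \<comment> \<open>Otherwise the descent \<open>x y\<close> would end at or before
      \<open>p\<close>, against \<open>peak_left\<close>. Hence some point lies to the lower right
      of \<open>p\<close>, and \<open>q\<close> can be taken as the leftmost such point.\<close>
    have "pos p < pos y"
      using peak_left[OF pS(1) \<open>p \<notin> N\<close>, of x y] xy low[of x] low[of y] pS nS by force
    define Q where "Q = {z \<in> S. val z \<le> val p \<and> pos p < pos z}"
    have "finite Q" "y \<in> Q" using fin xy \<open>pos p < pos y\<close> low[of y] unfolding Q_def by auto
    then obtain q where "q \<in> Q" and q_min: "\<And>z. z \<in> Q \<Longrightarrow> pos q \<le> pos z"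
      using finite_min[of Q pos] by blast
    then have q: "q \<in> S" "val q < val p" "pos p < pos q" "pos q < pos n"
      using val_neq[of p q] pS q_min[OF \<open>y \<in> Q\<close>] xy unfolding Q_def by auto
    have gap: "pos q \<le> pos z" if "z \<in> S" "val z \<le> val p" "pos p < pos z" for z
      using q_min that unfolding Q_def by blast
    \<comment> \<open>A point \<open>m\<close> before \<open>q\<close> in this range would lie above
      \<open>n\<close>, and \<open>m q n\<close> would be a 312.\<close>
    have mid: "pos q < pos m" if "m \<in> S" "val p < val m" "val m \<le> val v" for m
    proof (rule ccontr)
      assume "\<not> pos q < pos m"
      then have "pos m < pos q" using pos_neq[of m q] that q by (cases "m = q") auto
      moreover from this have "val n < val m" using val_neq[of m n] low[of m] that q nS by force
      ultimately show False using no312[of m q n] that q pS nS by auto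
    qed
    \<comment> \<open>A descent \<open>m m'\<close> would complete the 2143
      \<open>p q m m'\<close>.\<close>
    have mid_inc: "val m < val m'" if "m \<in> S" "m' \<in> S" "val p < val m" "val p < val m'" "val m \<le> val v" "val m' \<le> val v" "pos m < pos m'" for m m'
      using no2143[of p q m m'] mid[of m] val_neq[of m m'] that q pS by force
    show ?thesis
    \<comment> \<open>The first line stands just before \<open>q\<close>, not just after
      \<open>p\<close>: the 2143 \<open>p q x v\<close> excludes points above \<open>v\<close> only
      between \<open>q\<close> and \<open>v\<close>. The second line is at \<open>v\<close>, the
      last of the increasing middle points.\<close>
    proof (rule gridded_EI[OF inj, of "pos q - 1" "pos v" "val p" "val v"])
      show "pos q - 1 \<le> pos v" using mid[of v] S pS nS by auto
      show "val p \<le> val v" using pS nS by auto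
    next
      fix x y assume a: "x \<in> S" "y \<in> S" "val x \<le> val p" "val y \<le> val p" "pos x < pos y" "pos y \<le> pos q - 1"
      then have "pos y \<le> pos p" using gap[of y] by force
      then show "val x < val y" using peak_left[OF pS(1) \<open>p \<notin> N\<close>] a pS nS by auto
    next
      fix x y assume a: "x \<in> S" "y \<in> S" "val x \<le> val p" "val y \<le> val p" "pos q - 1 < pos x" "pos x < pos y"
      then show "val y < val x" using peak_right[OF pS(1), of x y] pS nS q by auto
    next
      fix x assume a: "x \<in> S" "val p < val x" "val x \<le> val v"
      then have "pos x \<le> pos v" using mid_inc[of v x] S by force
      then show "pos q - 1 < pos x \<and> pos x \<le> pos v" using mid[OF a] by simp
    next
      fix x assume a: "x \<in> S" "val v < val x"
      show "pos x \<le> pos q - 1 \<or> pos v < pos x"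
      proof (rule ccontr)
        assume "\<not> ?thesis"
        then have "pos q < pos x" "pos x < pos v"
          using a q S pS nS pos_neq[of x q] pos_neq[of x v] by fastforce+
        then show False using no2143[of p q x v] a q S pS nS by auto
      qed
    qed (use mid_inc high' in auto)
  qed
qed

lemma avoids_gridded:
  assumes fin: "finite S" and inj: "inj_on pos S" "inj_on val S" and av: "avoids S pos val"
  shows "gridded S pos val 4 6 matrix_E \<or> gridded S pos val 6 4 matrix_F"
proof -
  define D where "D = {z \<in> S. \<exists>x\<in>S. pos x < pos z \<and> val z < val x}"
  have no2143: False if "a \<in> S" "b \<in> S" "c \<in> S" "d \<in> S" "pos a < pos b" "pos b < pos c" "pos c < pos d"
      "val b < val a" "val a < val d" "val d < val c" for a b c d
    using av that unfolding avoids_def by blast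
  \<comment> \<open>Two points outside \<open>D\<close> cannot form a descent, since its lower end
    would belong to \<open>D\<close>.\<close>
  have inc: "val x < val y \<longleftrightarrow> pos x < pos y" if "x \<in> S" "y \<in> S" "x \<notin> D" "y \<notin> D" for x y
  proof (cases "x = y")
    case False
    then have "pos x \<noteq> pos y" "val x \<noteq> val y"
      using that inj_onD[OF inj(1), of x y] inj_onD[OF inj(2), of x y] by auto
    then show ?thesis using that unfolding D_def by force
  qed simp
  show ?thesis
  proof (cases "D = {}")
    case True
    have "gridded S pos val 4 6 matrix_E"
      unfolding gridded_def
      by (rule exI[of _ "\<lambda>_. 1"], rule exI[of _ "\<lambda>_. 1"]) (use inc True in \<open>auto simp: cells_def\<close>)
    then show ?thesis ..
  next
    case False
    have "finite D" using fin unfolding D_def by simp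
    then obtain v where v: "v \<in> D" and v_max: "\<And>z. z \<in> D \<Longrightarrow> val z \<le> val v"
      using False finite_max[of D val] by blast
    obtain w where w: "w \<in> D" and w_min: "\<And>z. z \<in> D \<Longrightarrow> pos w \<le> pos z"
      using \<open>finite D\<close> False finite_min[of D pos] by blast
    have S: "v \<in> S" "w \<in> S" using v w unfolding D_def by auto
    obtain s where s: "s \<in> S" "pos s < pos v" "val v < val s" using v unfolding D_def by auto
    have left: "val x < val y" if "x \<in> S" "y \<in> S" "pos x < pos y" "pos y < pos w" for x y
      using inc[of x y] that w_min[of x] w_min[of y] by force
    have high: "pos x < pos y" if "x \<in> S" "y \<in> S" "val v < val x" "val x < val y" for x y
      using inc[of x y] that v_max[of x] v_max[of y] by force
    obtain t where t: "t \<in> S" "pos t < pos w" "val v < val t"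
    proof -
      obtain u where u: "u \<in> S" "pos u < pos w" "val w < val u" using w unfolding D_def by auto
      \<comment> \<open>If \<open>u\<close> lies below \<open>v\<close>, then \<open>s\<close> must
        come before \<open>w\<close>, since otherwise \<open>u w s v\<close> is a 2143; so
        \<open>s\<close> serves as \<open>t\<close>.\<close>
      show thesis
      proof (cases "val v < val u")
        case True
        then show thesis using that u by blast
      next
        case False
        then have "val u < val v"
          using u s S w_min[OF v] inj_onD[OF inj(2), of u v] by force
        then have "\<not> pos w < pos s" using no2143[of u w s v] u s S by auto
        moreover have "s \<noteq> w" using v_max[OF w] s by auto
        ultimately have "pos s < pos w" using inj_onD[OF inj(1), of s w] s S by force
        then show thesis using that s by blast
      qed
    qed
    note tvw = t(2) w_min[OF v] v_max[OF w] t(3)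
    show ?thesis
    proof (cases "\<forall>x\<in>S. pos x < pos w \<longrightarrow> val x \<le> val v \<longrightarrow> val x < val w")
      case True
      then show ?thesis
        using avoids_gridded_E[OF fin inj av t(1) S tvw left high] by blast
    next
      case False
      then obtain i where i: "i \<in> S" "pos i < pos w" "val i \<le> val v" "\<not> val i < val w" by blast
      then have "val w < val i" "val i < val v"
        using inj_onD[OF inj(2), of i w] inj_onD[OF inj(2), of i v] S w_min[OF v] by force+
      \<comment> \<open>A point \<open>x\<close> above \<open>v\<close> and between \<open>w\<close>
        and \<open>v\<close> would complete the 2143 \<open>i w x v\<close>. This is the reflected
        form of the hypothesis \<open>sep\<close> of \<open>avoids_gridded_E\<close>.\<close>
      have sep: "pos v < pos x" if "x \<in> S" "val v < val x" "pos w \<le> pos x" for x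
      proof -
        have "x \<noteq> w" "x \<noteq> v" using that v_max[OF w] by auto
        then have "pos x \<noteq> pos w" "pos x \<noteq> pos v"
          using that S inj_onD[OF inj(1)] by blast+
        then show ?thesis
          using no2143[of i w x v] that i S \<open>val w < val i\<close> \<open>val i < val v\<close>
          by (cases "pos x < pos v") auto
      qed
      \<comment> \<open>The reflection exchanges \<open>v\<close> with \<open>w\<close> and
        \<open>left\<close> with \<open>high\<close>.\<close>
      have "gridded S (\<lambda>x. - val x) (\<lambda>x. - pos x) 4 6 matrix_E"
        by (rule avoids_gridded_E[OF fin _ _ avoids_reflect[OF av] t(1) S(2) S(1)])
          (use inj tvw left high sep in \<open>simp_all add: inj_on_def\<close>)
      then show ?thesis using gridded_F_iff_gridded_E[OF inj] by blast
    qed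
  qed
qed

section \<open>Permutations as point sets\<close>

lemma subseq_Cons_iff_nth:
  "subseq (x # xs) ys \<longleftrightarrow> (\<exists>i < length ys. ys ! i = x \<and> subseq xs (drop (Suc i) ys))"
proof
  assume "subseq (x # xs) ys"
  from list_emb_ConsD[OF this] obtain us vs where "ys = us @ x # vs" "subseq xs vs"
    by blast
  then show "\<exists>i < length ys. ys ! i = x \<and> subseq xs (drop (Suc i) ys)"
    by (intro exI[of _ "length us"]) auto
next
  assume "\<exists>i < length ys. ys ! i = x \<and> subseq xs (drop (Suc i) ys)"
  then obtain i where i: "i < length ys" "ys ! i = x" "subseq xs (drop (Suc i) ys)" by blast
  then have ys: "ys = take i ys @ x # drop (Suc i) ys"
    using id_take_nth_drop by blast
  have "subseq (x # xs) (take i ys @ x # drop (Suc i) ys)"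
    using i(3) by (intro list_emb_append2) auto
  then show "subseq (x # xs) ys" by (subst ys)
qed

lemma subseq_length4_iff_nth:
  "subseq [x, y, z, u] ys \<longleftrightarrow> (\<exists>i j k l. i < j \<and> j < k \<and> k < l \<and> l < length ys \<and>
     x = ys ! i \<and> y = ys ! j \<and> z = ys ! k \<and> u = ys ! l)"
proof
  assume "subseq [x, y, z, u] ys"
  \<comment> \<open>Each index is relative to the suffix after the preceding letter, hence the
    sums.\<close>
  then obtain i j k l where "i < length ys" "ys ! i = x" "j < length ys - Suc i" "ys ! (Suc i + j) = y"
    "k < length ys - Suc (Suc (i + j))" "ys ! (Suc (Suc (i + j)) + k) = z"
    "l < length ys - Suc (Suc (Suc (i + j + k)))" "ys ! (Suc (Suc (Suc (i + j + k))) + l) = u"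
    by (auto simp: subseq_Cons_iff_nth ac_simps)
  then show "\<exists>i j k l. i < j \<and> j < k \<and> k < l \<and> l < length ys \<and>
     x = ys ! i \<and> y = ys ! j \<and> z = ys ! k \<and> u = ys ! l"
    by (intro exI[of _ i] exI[of _ "Suc i + j"] exI[of _ "Suc (Suc (i + j)) + k"]
        exI[of _ "Suc (Suc (Suc (i + j + k))) + l"]) auto
next
  assume "\<exists>i j k l. i < j \<and> j < k \<and> k < l \<and> l < length ys \<and>
     x = ys ! i \<and> y = ys ! j \<and> z = ys ! k \<and> u = ys ! l"
  then obtain i j k l where "i < j" "j < k" "k < l" "l < length ys"
     "x = ys ! i" "y = ys ! j" "z = ys ! k" "u = ys ! l" by blast
  moreover from this have "subseq [u] (drop (Suc k) ys)"
    by (subst subseq_Cons_iff_nth) (auto intro!: exI[of _ "l - Suc k"])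
  moreover from calculation have "subseq [z, u] (drop (Suc j) ys)"
    by (subst subseq_Cons_iff_nth) (auto intro!: exI[of _ "k - Suc j"])
  moreover from calculation have "subseq [y, z, u] (drop (Suc i) ys)"
    by (subst subseq_Cons_iff_nth) (auto intro!: exI[of _ "j - Suc i"])
  ultimately show "subseq [x, y, z, u] ys"
    by (subst subseq_Cons_iff_nth) (auto intro!: exI[of _ i])
qed

lemma contains_pattern_length4:
  "contains_pattern \<pi> [a, b, c, d] \<longleftrightarrow> (\<exists>i j k l. i < j \<and> j < k \<and> k < l \<and> l < length \<pi> \<and>
     order_isomorphic [\<pi> ! i, \<pi> ! j, \<pi> ! k, \<pi> ! l] [a, b, c, d])"
proof -
  have "order_isomorphic \<tau> [a, b, c, d] \<Longrightarrow> \<exists>x y z u. \<tau> = [x, y, z, u]" for \<tau>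
    by (auto simp: order_isomorphic_def length_Suc_conv)
  then have "contains_pattern \<pi> [a, b, c, d] \<longleftrightarrow>
      (\<exists>x y z u. subseq [x, y, z, u] \<pi> \<and> order_isomorphic [x, y, z, u] [a, b, c, d])"
    unfolding contains_pattern_def by blast
  then show ?thesis unfolding subseq_length4_iff_nth by blast
qed

lemma all_less_length4:
  "(\<forall>i < length [a, b, c, d]. P i) \<longleftrightarrow> P 0 \<and> P 1 \<and> P 2 \<and> P (3 :: nat)"
  by (auto simp: less_Suc_eq numeral_eq_Suc)

lemma order_isomorphic_2143:
  "order_isomorphic [x, y, z, u] [2, 1, 4, 3] \<longleftrightarrow> y < x \<and> x < u \<and> u < z"
  unfolding order_isomorphic_def all_less_length4 by auto

lemma order_isomorphic_4312:
  "order_isomorphic [x, y, z, u] [4, 3, 1, 2] \<longleftrightarrow> z < u \<and> u < y \<and> y < x"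
  unfolding order_isomorphic_def all_less_length4 by auto

lemma Av_iff_avoids:
  "\<pi> \<in> Av {[2,1,4,3], [4,3,1,2]} \<longleftrightarrow>
     \<pi> \<in> perms \<and> avoids {..<length \<pi>} int (\<lambda>i. int (\<pi> ! i))"
proof -
  have "avoids {..<length \<pi>} int (\<lambda>i. int (\<pi> ! i)) \<longleftrightarrow>
    (\<forall>i j k l. i < j \<longrightarrow> j < k \<longrightarrow> k < l \<longrightarrow> l < length \<pi> \<longrightarrow>
      \<not> (\<pi> ! j < \<pi> ! i \<and> \<pi> ! i < \<pi> ! l \<and> \<pi> ! l < \<pi> ! k) \<and>
      \<not> (\<pi> ! k < \<pi> ! l \<and> \<pi> ! l < \<pi> ! j \<and> \<pi> ! j < \<pi> ! i))" (is "?L \<longleftrightarrow> ?R")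
  proof
    assume L: ?L
    show ?R
    proof (intro allI impI)
      fix i j k l assume "i < j" "j < k" "k < l" "l < length \<pi>"
      then show "\<not> (\<pi> ! j < \<pi> ! i \<and> \<pi> ! i < \<pi> ! l \<and> \<pi> ! l < \<pi> ! k) \<and>
          \<not> (\<pi> ! k < \<pi> ! l \<and> \<pi> ! l < \<pi> ! j \<and> \<pi> ! j < \<pi> ! i)"
        using L[unfolded avoids_def, rule_format, of i j k l] by simp
    qed
  next
    assume ?R
    then show ?L unfolding avoids_def by simp
  qed
  moreover have "\<pi> \<in> Av {[2,1,4,3], [4,3,1,2]} \<longleftrightarrow> \<pi> \<in> perms \<and>
      \<not> contains_pattern \<pi> [2,1,4,3] \<and> \<not> contains_pattern \<pi> [4,3,1,2]"
    unfolding Av_def by blast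
  ultimately show ?thesis
    unfolding contains_pattern_length4 order_isomorphic_2143 order_isomorphic_4312 by blast
qed

section \<open>Grid lines versus assignments of columns and rows\<close>

lemma perms_nth:
  assumes "\<pi> \<in> perms"
  shows "bij_betw ((!) \<pi>) {..<length \<pi>} {1..length \<pi>}"
proof -
  obtain n where n: "set \<pi> = {1..n}" "distinct \<pi>"
    using assms unfolding perms_def permutations_of_set_def by blast
  then have "length \<pi> = n" using distinct_card by fastforce
  then show ?thesis using bij_betw_nth n by blast
qed

text \<open>Turns an assignment of columns (or rows) that is monotone in the coordinate \<open>f\<close>
  into grid lines.\<close>

lemma le_card_iff_of_monotone:
  fixes f F :: "'a \<Rightarrow> nat"
  assumes "bij_betw f S {1..n}"
    and mono: "\<And>x y. x \<in> S \<Longrightarrow> y \<in> S \<Longrightarrow> f x < f y \<Longrightarrow> F x \<le> F y"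
    and "x \<in> S"
  shows "f x \<le> card {y \<in> S. F y \<le> i} \<longleftrightarrow> F x \<le> i"
proof -
  let ?A = "{y \<in> S. F y \<le> i}"
  have inj: "inj_on f S" and img: "f ` S = {1..n}" using assms(1) by (auto simp: bij_betw_def)
  have fin: "finite S" using bij_betw_finite[OF assms(1)] by simp
  have card: "card (f ` ?A) = card ?A"
    by (rule card_image) (rule inj_on_subset[OF inj], auto)
  show ?thesis
  proof
    assume "F x \<le> i"
    \<comment> \<open>Every value up to \<open>f x\<close> is attained, and by monotonicity at a
      point whose column is at most \<open>i\<close>.\<close>
    have "{1..f x} \<subseteq> f ` ?A"
    proof
      fix k assume "k \<in> {1..f x}"
      moreover have "f x \<in> {1..n}" using assms(3) img by blast
      ultimately have "k \<in> f ` S" unfolding img by auto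
      then obtain y where y: "y \<in> S" "k = f y" by blast
      have "F y \<le> i"
        using mono[of y x] y assms(3) \<open>F x \<le> i\<close> \<open>k \<in> {1..f x}\<close> inj_onD[OF inj, of y x]
        by (cases "f y = f x") auto
      then show "k \<in> f ` ?A" using y by blast
    qed
    from card_mono[OF _ this] show "f x \<le> card ?A" using fin card by simp
  next
    assume le: "f x \<le> card ?A"
    show "F x \<le> i"
    proof (rule ccontr)
      assume "\<not> F x \<le> i"
      \<comment> \<open>If the column of \<open>x\<close> exceeds \<open>i\<close>, all points
        counted come strictly before \<open>x\<close>, so they are too few.\<close>
      have "f ` ?A \<subseteq> {1..<f x}"
      proof
        fix k assume "k \<in> f ` ?A"
        then obtain y where y: "y \<in> S" "F y \<le> i" "k = f y" by blast
        then have "f y < f x"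
          using mono[of x y] \<open>\<not> F x \<le> i\<close> assms(3) inj_onD[OF inj, of x y] by fastforce
        moreover have "f y \<in> {1..n}" using y img by blast
        ultimately show "k \<in> {1..<f x}" using y by simp
      qed
      from card_mono[OF _ this] have "card ?A \<le> f x - 1" using card by simp
      moreover have "f x \<in> {1..n}" using assms(3) img by blast
      ultimately show False using le by (cases "f x") auto
    qed
  qed
qed

lemma conforms_iff:
  "conforms m A \<longleftrightarrow> (m = Empty \<longrightarrow> A = {}) \<and>
     (m = Increasing \<longrightarrow> (\<forall>x \<in> A. \<forall>y \<in> A. fst x < fst y \<longrightarrow> snd x < snd y)) \<and>
     (m = Decreasing \<longrightarrow> (\<forall>x \<in> A. \<forall>y \<in> A. fst x < fst y \<longrightarrow> snd y < snd x))"
  by (cases m) (auto simp: case_prod_beta)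

lemma conforms_subset: "conforms m B \<Longrightarrow> A \<subseteq> B \<Longrightarrow> conforms m A"
  by (cases m) (auto simp: conforms_iff subset_iff)

lemma points_eq: "points \<pi> = (\<lambda>i. (Suc i, \<pi> ! i)) ` {..<length \<pi>}"
proof -
  have "(p, \<pi> ! (p - 1)) \<in> (\<lambda>i. (Suc i, \<pi> ! i)) ` {..<length \<pi>}" if "1 \<le> p" "p \<le> length \<pi>" for p
    using that by (intro image_eqI[of _ _ "p - 1"]) auto
  then show ?thesis unfolding points_def by force
qed

text \<open>Lines give each point the column and row it falls into; conversely, the i-th line is
  recovered as the number of points in columns (rows) up to i.\<close>

lemma grid_class_iff_gridded:
  assumes "\<pi> \<in> perms"
  shows "\<pi> \<in> grid_class k l M \<longleftrightarrow> gridded {..<length \<pi>} int (\<lambda>i. int (\<pi> ! i)) k l M"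
proof
  let ?S = "{..<length \<pi>}"
  have bij: "bij_betw ((!) \<pi>) ?S {1..length \<pi>}" using perms_nth[OF assms] .
  then have nth: "\<pi> ! x \<in> {1..length \<pi>}" if "x \<in> ?S" for x
    using that unfolding bij_betw_def by blast
  {
    assume "\<pi> \<in> grid_class k l M"
    then obtain c r :: "nat \<Rightarrow> nat" where c: "c 0 = 0" "c k = length \<pi>"
      and r: "r 0 = 0" "r l = length \<pi>"
      and cell: "\<And>i j. i \<in> {1..k} \<Longrightarrow> j \<in> {1..l} \<Longrightarrow>
        conforms (M i j) (points \<pi> \<inter> ({c (i - 1)<..c i} \<times> {r (j - 1)<..r j}))"
      unfolding grid_class_def by blast
    \<comment> \<open>Cells are closed on the right, so the column is the first line not before the
      point. List index \<open>x\<close> is position \<open>Suc x\<close>, and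
      \<open>c 0 = 0\<close> makes columns start at 1.\<close>
    define C where "C x = (LEAST i. Suc x \<le> c i)" for x
    define R where "R x = (LEAST j. \<pi> ! x \<le> r j)" for x
    have C: "Suc x \<le> c (C x)" "C x \<le> k" "C x \<ge> 1" "c (C x - 1) < Suc x" if "x \<in> ?S" for x
    proof -
      have *: "Suc x \<le> c k" using that c by simp
      show "Suc x \<le> c (C x)" unfolding C_def by (rule LeastI) (rule *)
      show "C x \<le> k" unfolding C_def by (rule Least_le) (rule *)
      show "C x \<ge> 1" using \<open>Suc x \<le> c (C x)\<close> c(1) by (cases "C x") auto
      then have "C x - 1 < (LEAST i. Suc x \<le> c i)" unfolding C_def[symmetric] by simp
      then show "c (C x - 1) < Suc x" using not_less_Least by (metis not_le)
    qed
    have R: "\<pi> ! x \<le> r (R x)" "R x \<le> l" "R x \<ge> 1" "r (R x - 1) < \<pi> ! x" if "x \<in> ?S" for x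
    proof -
      have *: "\<pi> ! x \<le> r l" using nth[OF that] r by simp
      show "\<pi> ! x \<le> r (R x)" unfolding R_def by (rule LeastI) (rule *)
      show "R x \<le> l" unfolding R_def by (rule Least_le) (rule *)
      show "R x \<ge> 1" using \<open>\<pi> ! x \<le> r (R x)\<close> r(1) nth[OF that] by (cases "R x") auto
      then have "R x - 1 < (LEAST j. \<pi> ! x \<le> r j)" unfolding R_def[symmetric] by simp
      then show "r (R x - 1) < \<pi> ! x" using not_less_Least by (metis not_le)
    qed
    have mem: "(Suc x, \<pi> ! x) \<in> points \<pi> \<inter> ({c (C x - 1)<..c (C x)} \<times> {r (R x - 1)<..r (R x)})"
      if "x \<in> ?S" for x
      using C[OF that] R[OF that] that by (auto simp: points_eq)
    show "gridded ?S int (\<lambda>i. int (\<pi> ! i)) k l M"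
      unfolding gridded_def
    proof (rule exI[of _ C], rule exI[of _ R], intro ballI conjI impI)
      fix x assume x: "x \<in> ?S"
      show "C x \<in> {1..k}" "R x \<in> {1..l}" using C[OF x] R[OF x] by auto
      note cellx = cell[OF this, unfolded conforms_iff]
      show "M (C x) (R x) \<noteq> Empty" using cellx mem[OF x] by blast
      fix y assume y: "y \<in> ?S"
      show "C x \<le> C y" if "int x < int y"
        unfolding C_def[of x] by (rule Least_le) (use C(1)[OF y] that in simp)
      show "R x \<le> R y" if "int (\<pi> ! x) < int (\<pi> ! y)"
        unfolding R_def[of x] by (rule Least_le) (use R(1)[OF y] that in simp)
      assume xy: "int x < int y" "C x = C y" "R x = R y"
      note memy = mem[OF y, folded xy(2,3)]
      show "int (\<pi> ! x) < int (\<pi> ! y)" if "M (C x) (R x) = Increasing"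
      proof -
        have "fst (Suc x, \<pi> ! x) < fst (Suc y, \<pi> ! y) \<longrightarrow> snd (Suc x, \<pi> ! x) < snd (Suc y, \<pi> ! y)"
          using cellx that mem[OF x] memy by blast
        then show ?thesis using xy by simp
      qed
      show "int (\<pi> ! y) < int (\<pi> ! x)" if "M (C x) (R x) = Decreasing"
      proof -
        have "fst (Suc x, \<pi> ! x) < fst (Suc y, \<pi> ! y) \<longrightarrow> snd (Suc y, \<pi> ! y) < snd (Suc x, \<pi> ! x)"
          using cellx that mem[OF x] memy by blast
        then show ?thesis using xy by simp
      qed
    qed
  next
    assume "gridded ?S int (\<lambda>i. int (\<pi> ! i)) k l M"
    then obtain C R where CR: "\<And>x. x \<in> ?S \<Longrightarrow> C x \<in> {1..k}" "\<And>x. x \<in> ?S \<Longrightarrow> R x \<in> {1..l}"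
        "\<And>x. x \<in> ?S \<Longrightarrow> M (C x) (R x) \<noteq> Empty"
      and mono: "\<And>x y. x \<in> ?S \<Longrightarrow> y \<in> ?S \<Longrightarrow> int x < int y \<Longrightarrow> C x \<le> C y"
        "\<And>x y. x \<in> ?S \<Longrightarrow> y \<in> ?S \<Longrightarrow> int (\<pi> ! x) < int (\<pi> ! y) \<Longrightarrow> R x \<le> R y"
      and cell: "\<And>x y. x \<in> ?S \<Longrightarrow> y \<in> ?S \<Longrightarrow> int x < int y \<Longrightarrow> C x = C y \<Longrightarrow> R x = R y \<Longrightarrow>
         (M (C x) (R x) = Increasing \<longrightarrow> int (\<pi> ! x) < int (\<pi> ! y)) \<and>
         (M (C x) (R x) = Decreasing \<longrightarrow> int (\<pi> ! y) < int (\<pi> ! x))"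
      unfolding gridded_def by blast
    define c where "c i = card {x \<in> ?S. C x \<le> i}" for i
    define r where "r j = card {x \<in> ?S. R x \<le> j}" for j
    have "bij_betw Suc ?S {1..length \<pi>}"
      by (rule bij_betw_byWitness[of _ "\<lambda>x. x - 1"]) auto
    then have c: "Suc x \<le> c i \<longleftrightarrow> C x \<le> i" if "x \<in> ?S" for x i
      unfolding c_def by (rule le_card_iff_of_monotone) (use mono(1) that in auto)
    have r: "\<pi> ! x \<le> r j \<longleftrightarrow> R x \<le> j" if "x \<in> ?S" for x j
      unfolding r_def using bij by (rule le_card_iff_of_monotone) (use mono(2) that in auto)
    \<comment> \<open>This includes \<open>i = 0\<close>, where truncated subtraction makes the
      interval empty.\<close>
    have C_eq: "C x = i" if "x \<in> ?S" "Suc x \<in> {c (i - 1)<..c i}" for x i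
      using that c[of x i] c[of x "i - 1"] by auto
    have R_eq: "R x = j" if "x \<in> ?S" "\<pi> ! x \<in> {r (j - 1)<..r j}" for x j
      using that r[of x j] r[of x "j - 1"] by auto
    have ends: "c 0 = 0" "c k = length \<pi>" "r 0 = 0" "r l = length \<pi>"
    proof -
      have "{x \<in> ?S. C x \<le> 0} = {}" "{x \<in> ?S. R x \<le> 0} = {}" "{x \<in> ?S. C x \<le> k} = ?S" "{x \<in> ?S. R x \<le> l} = ?S"
        using CR(1,2) by fastforce+
      then show "c 0 = 0" "c k = length \<pi>" "r 0 = 0" "r l = length \<pi>"
        unfolding c_def r_def by (simp_all only: card.empty card_lessThan)
    qed
    have mono_on: "mono_on A c" "mono_on A r" for A
      unfolding c_def r_def by (auto intro!: mono_onI card_mono)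
    have conforms: "conforms (M i j) (points \<pi> \<inter> ({c (i - 1)<..c i} \<times> {r (j - 1)<..r j}))" for i j
    proof -
      have eq: "points \<pi> \<inter> ({c (i - 1)<..c i} \<times> {r (j - 1)<..r j}) \<subseteq>
          (\<lambda>x. (Suc x, \<pi> ! x)) ` {x \<in> ?S. C x = i \<and> R x = j}" (is "_ \<subseteq> ?P")
        using C_eq R_eq unfolding points_eq by blast
      have "conforms (M i j) ?P"
        unfolding conforms_iff
      proof (intro conjI impI ballI)
        show "?P = {}" if "M i j = Empty"
          using CR(3) that by blast
      next
        fix p q assume "p \<in> ?P" "q \<in> ?P" "fst p < fst q"
        then obtain x y where xy: "p = (Suc x, \<pi> ! x)" "q = (Suc y, \<pi> ! y)" "x \<in> ?S" "y \<in> ?S"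
          "x < y" "C x = i" "R x = j" "C y = i" "R y = j" by auto
        then show "snd p < snd q" if "M i j = Increasing"
          using cell[of x y] that by simp
        show "snd q < snd p" if "M i j = Decreasing"
          using cell[of x y] that xy by simp
      qed
      then show ?thesis using eq conforms_subset by blast
    qed
    show "\<pi> \<in> grid_class k l M"
      unfolding grid_class_def
      by (intro CollectI conjI assms, rule exI[of _ c], rule exI[of _ r]) (intro conjI ends mono_on conforms ballI)
  }
qed

theorem theorem4p1: "Av {[2,1,4,3], [4,3,1,2]} = class_E \<union> class_F"
proof (rule set_eqI)
  fix \<pi>
  let ?S = "{..<length \<pi>}" and ?val = "\<lambda>i. int (\<pi> ! i)"
  show "\<pi> \<in> Av {[2,1,4,3], [4,3,1,2]} \<longleftrightarrow> \<pi> \<in> class_E \<union> class_F"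
  proof (cases "\<pi> \<in> perms")
    case False
    then show ?thesis unfolding Av_def class_E_def class_F_def grid_class_def by blast
  next
    case True
    have inj: "inj_on int ?S" "inj_on ?val ?S"
      using perms_nth[OF True] by (auto simp: bij_betw_def inj_on_def)
    have "avoids ?S int ?val \<longleftrightarrow> gridded ?S int ?val 4 6 matrix_E \<or> gridded ?S int ?val 6 4 matrix_F"
      \<comment> \<open>For \<open>matrix_F\<close>, the reflected points are gridded by
        \<open>matrix_E\<close> and hence avoid both patterns; reflecting back returns to the
        original coordinates.\<close>
      using avoids_gridded[OF _ inj] gridded_E_avoids gridded_F_iff_gridded_E[OF inj]
        avoids_reflect[of ?S "\<lambda>i. - ?val i" "\<lambda>i. - int i"] by auto
    then show ?thesis
      unfolding Un_iff Av_iff_avoids class_E_def class_F_def grid_class_iff_gridded[OF True]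
      using True by blast
  qed
qed

end
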